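(* Let $r\ge 2$, $k \ge 1$ and $n \ge sk$ be integers. Write the prime factorization of $r$ as $r = 2^{\alpha_0}\cdot p_1^{\alpha_1} \cdots p_t^{\alpha_t}$, where $p_1,\dots,p_t$ are pairwise distinct odd primes and $\alpha_i \in \mathbb{Z}_{\ge 0}$, and let $s$ be an integer with $2 \le s \le 2^{\alpha_0}\cdot (p_1-1)^{\alpha_1} \cdots (p_t-1)^{\alpha_t}$. Then for every coloring of the $k$-element subsets of $[n]=\{1,\dots,n\}$ with fewer than $\left\lceil \frac{(s-1)n-r(k-1)}{r-1} \right\rceil$ colors, there exist $k$-element subsets $A_1,\dots,A_r \subseteq [n]$ (not necessarily distinct) that all receive the same color and such that $A_{i_1}\cap \dots \cap A_{i_s} = \emptyset$ for all pairwise distinct indices $i_1,\dots,i_s \in [r]$. Equivalently, at least $\left\lceil \frac{(s-1)n-r(k-1)}{r-1} \right\rceil$ colors are required in any coloring of the $k$-subsets of $[n]$ which ensures that among any $r$ (not necessarily distinct) same-colored $k$-subsets, some $s$ of them (taken at distinct positions) have a common element.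
   Context: Here "some $s$ of them intersect" means that all $s$ sets share a common element (not merely pairwise intersections); the $r$ sets form a sequence in which repetitions are allowed, and choosing $s$ of them means choosing $s$ distinct positions in the sequence. *)

theory Defs
  imports Complex_Main "HOL-Library.Ramsey" "HOL-Computational_Algebra.Primes"
begin

end

theory Submission
  imports Defs "HOL-Number_Theory.Cong"
begin

text \<open>
  More generally, if $\sum_x b_x > m(r-1) + r(k-1)$ with $b_x \le r$, then every colouring of the
  $k$-subsets with $m$ colours has $r$ sets of one colour covering each point $x$ at most $b_x$
  times; the theorem is the case of constant $b_x = s - 1$.

  For a prime $r = p$ and $b_x < p$, replace $x$ by $b_x$ clones. A partial labelling of the clones
  by $\mathbb{Z}_p$ gives $p$ sets covering each $x$ at most $b_x$ times. If no suitable family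
  existed, the sizes of these sets and the colours occurring inside each of them would define an
  equivariant map of the poset of nonzero labellings that contradicts a $\mathbb{Z}_p$-Tucker lemma.
  Points with $b_x = p$ may be put into all $p$ sets.

  For $r = pq$, clone each point $q$ times. A subset $N$ of the clones with more than
  $m(q-1) + q(k-1)$ elements contains, by the case $q$ with the clone multiplicities of $N$ as $b$,
  a monochromatic $q$-family; give $N$ its colour and apply the case $p$ to these sets $N$.
  The two bounds compose exactly.

  The Tucker lemma is proved by cochains on lists: chains $e_d$ of flags with boundary alternately
  $(\tau - 1) e_{d-1}$ and $(1 + \tau + \dots + \tau^{p-1}) e_{d-1}$ are paired with cochains
  $\psi_d$ of sign sequences having dual coboundaries. The pairing is 1 modulo $p$ in every
  dimension, while $\psi_d$ vanishes on flags having two consecutive signs equal.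
\<close>

section \<open>Cochains on lists\<close>

text \<open>The simplicial coboundary: an alternating sum over the deletions of one entry, defined
  for all lengths at once.\<close>

fun cobd :: "('a list \<Rightarrow> int) \<Rightarrow> 'a list \<Rightarrow> int" where
  "cobd f [] = 0"
| "cobd f (x # xs) = f xs - cobd (\<lambda>l. f (x # l)) xs"

text \<open>The dual prism operator: a signed sum of \<open>f\<close> over the lists
  \<open>x_0, ..., x_i, s x_i, ..., s x_m\<close>.\<close>

fun prism :: "('a \<Rightarrow> 'a) \<Rightarrow> ('a list \<Rightarrow> int) \<Rightarrow> 'a list \<Rightarrow> int" where
  "prism s f [] = 0"
| "prism s f (x # xs) = f (x # map s (x # xs)) - prism s (\<lambda>l. f (x # l)) xs"

text \<open>In the later use \<open>X\<close> and the apex \<open>v\<close> both lie below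
  \<open>s X\<close> but may be incomparable. So a list is first moved along the prism to its image
  under \<open>s\<close>, and that image is joined to \<open>v\<close>.\<close>

definition cone :: "'a \<Rightarrow> ('a \<Rightarrow> 'a) \<Rightarrow> ('a list \<Rightarrow> int) \<Rightarrow> 'a list \<Rightarrow> int" where
  "cone v s f xs = f (v # map s xs) - prism s f xs"

lemma cobd_diff: "cobd (\<lambda>l. f l - g l) xs = cobd f xs - cobd g xs"
  by (induction xs arbitrary: f g) auto

lemma cobd_zero [simp]: "cobd (\<lambda>l. 0) xs = 0"
  by (induction xs) auto

lemma cobd_add: "cobd (\<lambda>l. f l + g l) xs = cobd f xs + cobd g xs"
  by (induction xs arbitrary: f g) auto

lemma cobd_sum: "cobd (\<lambda>l. \<Sum>t<(n::nat). f t l) xs = (\<Sum>t<n. cobd (f t) xs)"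
  by (induction n) (auto simp: cobd_add)

lemma cobd_cmult: "cobd (\<lambda>l. a * f l) xs = a * cobd f xs"
  by (induction xs arbitrary: f) (auto simp: algebra_simps)

lemma cobd_map: "cobd f (map h xs) = cobd (\<lambda>l. f (map h l)) xs"
  by (induction xs arbitrary: f) auto

lemma cobd_cong:
  "(\<And>l. Suc (length l) = length xs \<Longrightarrow> f l = g l) \<Longrightarrow> cobd f xs = cobd g xs"
proof (induction xs arbitrary: f g)
  case (Cons x xs)
  have "cobd (\<lambda>l. f (x # l)) xs = cobd (\<lambda>l. g (x # l)) xs"
    by (rule Cons.IH) (auto intro: Cons.prems)
  then show ?case using Cons.prems by simp
qed auto

lemma prism_diff: "prism s (\<lambda>l. f l - g l) xs = prism s f xs - prism s g xs"
  by (induction xs arbitrary: f g) auto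

text \<open>The inner faces of the prism cancel in pairs and leave its two ends.\<close>

lemma prism_homotopy:
  "prism s (cobd f) xs + cobd (prism s f) xs = f (map s xs) - f xs"
proof (induction xs arbitrary: f)
  case (Cons x xs)
  show ?case
    using Cons.IH[of "\<lambda>l. f (x # l)"] by (simp add: prism_diff cobd_diff cobd_map)
qed simp

text \<open>Dually, the boundary of a cone is its base minus the cone over the boundary of the
  base.\<close>

lemma cone_cobd: "cone v s (cobd f) xs = f xs - cobd (cone v s f) xs"
  using prism_homotopy[of s f xs] by (simp add: cone_def[abs_def] cobd_diff cobd_map)

lemma cone_diff: "cone v s (\<lambda>l. f l - g l) xs = cone v s f xs - cone v s g xs"
  by (simp add: cone_def prism_diff)

lemma prism_dvd:
  fixes q :: int
  assumes "\<And>ys x zs. xs = ys @ x # zs \<Longrightarrow>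
    q dvd f (ys @ x # map s (x # zs)) - g (ys @ x # map s (x # zs))"
  shows "q dvd prism s f xs - prism s g xs"
  using assms
proof (induction xs arbitrary: f g)
  case (Cons x xs)
  have "q dvd prism s (\<lambda>l. f (x # l)) xs - prism s (\<lambda>l. g (x # l)) xs"
  proof (rule Cons.IH)
    fix ys y zs assume "xs = ys @ y # zs"
    then show "q dvd f (x # ys @ y # map s (y # zs)) - g (x # ys @ y # map s (y # zs))"
      using Cons.prems[of "x # ys" y zs] by simp
  qed
  moreover have "q dvd f (x # map s (x # xs)) - g (x # map s (x # xs))"
    using Cons.prems[of "[]" x xs] by simp
  ultimately have "q dvd (f (x # map s (x # xs)) - g (x # map s (x # xs)))
      - (prism s (\<lambda>l. f (x # l)) xs - prism s (\<lambda>l. g (x # l)) xs)"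
    by (rule dvd_diff[rotated])
  then show ?case by (simp add: algebra_simps)
qed simp

text \<open>The operators \<tau> - 1 and norm of the periodic resolution of the cyclic group of
  order \<open>p\<close>, selected by the parity of \<open>d\<close>.\<close>

definition alternate :: "('a \<Rightarrow> 'a) \<Rightarrow> nat \<Rightarrow> nat \<Rightarrow> ('a list \<Rightarrow> int) \<Rightarrow> 'a list \<Rightarrow> int" where
  "alternate \<tau> p d f l =
    (if even d then f (map \<tau> l) - f l else \<Sum>t<p. f (map (\<tau> ^^ t) l))"

lemma alternate_diff:
  "alternate \<tau> p d (\<lambda>l. f l - g l) xs = alternate \<tau> p d f xs - alternate \<tau> p d g xs"
  by (simp add: alternate_def sum_subtractf)

lemma alternate_cobd: "alternate \<tau> p d (cobd f) = cobd (alternate \<tau> p d f)"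
  by (rule ext) (simp add: alternate_def[abs_def] cobd_map cobd_diff cobd_sum)

lemma map_funpow: "map (\<tau> ^^ Suc t) l = map (\<tau> ^^ t) (map \<tau> l)"
  by (simp add: funpow_swap1)

text \<open>The product of \<tau> - 1 and the norm telescopes to \<open>\<tau> ^^ p\<close> minus
  the identity.\<close>

lemma alternate_alternate:
  assumes "map (\<tau> ^^ p) l = l"
  shows "alternate \<tau> p d (alternate \<tau> p (Suc d) f) l = 0"
proof -
  have "(\<Sum>t<p. f (map (\<tau> ^^ Suc t) l) - f (map (\<tau> ^^ t) l)) = f (map (\<tau> ^^ p) l) - f (map (\<tau> ^^ 0) l)"
    by (rule sum_lessThan_telescope)
  also have "\<dots> = 0" using assms by (simp)
  finally show ?thesis
    by (cases "even d") (auto simp: alternate_def sum_subtractf o_def funpow_swap1)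
qed

section \<open>Flags of signed vectors\<close>

definition rotate_map :: "nat \<Rightarrow> (nat \<rightharpoonup> nat) \<Rightarrow> (nat \<rightharpoonup> nat)" where
  "rotate_map p X = map_option (\<lambda>g. Suc g mod p) \<circ> X"

text \<open>Nonzero sign vectors of length \<open>n\<close>: the entry zero is encoded as
  \<open>None\<close>, and map extension serves as the order.\<close>

definition signed :: "nat \<Rightarrow> nat \<Rightarrow> (nat \<rightharpoonup> nat) set" where
  "signed p n = {X. X \<noteq> Map.empty \<and> dom X \<subseteq> {..<n} \<and> ran X \<subseteq> {..<p}}"

definition flag :: "nat \<Rightarrow> nat \<Rightarrow> (nat \<rightharpoonup> nat) list \<Rightarrow> bool" where
  "flag p n l \<longleftrightarrow> sorted_wrt (\<subseteq>\<^sub>m) l \<and> set l \<subseteq> signed p n"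

lemma rotate_map_signed:
  assumes "X \<in> signed p n" "0 < p"
  shows "rotate_map p X \<in> signed p n"
proof -
  obtain i g where "X i = Some g" using assms by (force simp: signed_def)
  then have "rotate_map p X i \<noteq> None" by (simp add: rotate_map_def)
  then have "rotate_map p X \<noteq> Map.empty" by (metis)
  then show ?thesis using assms by (auto simp: signed_def rotate_map_def ran_def dom_def)
qed

lemma rotate_map_mono: "X \<subseteq>\<^sub>m Y \<Longrightarrow> rotate_map p X \<subseteq>\<^sub>m rotate_map p Y"
  by (auto simp: map_le_def rotate_map_def dom_def) 

lemma rotate_map_funpow:
  "(rotate_map p ^^ t) X i = map_option (\<lambda>g. if t = 0 then g else (g + t) mod p) (X i)"
proof (induction t)
  case (Suc t)
  then show ?case
    by (cases "X i") (auto simp: rotate_map_def mod_Suc_eq)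
qed (simp add: option.map_ident)

lemma rotate_map_period:
  assumes "X \<in> signed p n"
  shows "(rotate_map p ^^ p) X = X"
proof
  fix i
  show "(rotate_map p ^^ p) X i = X i"
  proof (cases "X i")
    case (Some g)
    then have "g < p" using assms by (auto simp: signed_def ran_def)
    then show ?thesis using Some by (simp add: rotate_map_funpow)
  qed (simp add: rotate_map_funpow)
qed

lemma flag_rotate: "flag p n l \<Longrightarrow> 0 < p \<Longrightarrow> flag p n (map (rotate_map p) l)"
  by (auto simp: flag_def rotate_map_signed sorted_wrt_map subset_iff
      intro: sorted_wrt_mono_rel[of l "(\<subseteq>\<^sub>m)"] rotate_map_mono)

lemma flag_rotate_funpow: "flag p n l \<Longrightarrow> 0 < p \<Longrightarrow> flag p n (map (rotate_map p ^^ t) l)"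
proof (induction t arbitrary: l)
  case (Suc t)
  then show ?case unfolding map_funpow by (intro Suc.IH flag_rotate)
qed simp

lemma flag_period: "flag p n l \<Longrightarrow> map (rotate_map p ^^ p) l = l"
  by (rule map_idI) (auto simp: flag_def intro: rotate_map_period)

lemma upd_signed: "X \<in> signed p n \<or> X = Map.empty \<Longrightarrow> 0 < p \<Longrightarrow> X(n \<mapsto> 0) \<in> signed p (Suc n)"
  by (auto simp: signed_def ran_def less_Suc_eq)

lemma le_upd: "X \<in> signed p n \<Longrightarrow> X \<subseteq>\<^sub>m X(n \<mapsto> 0)"
  by (auto simp: signed_def map_le_def)

lemma upd_mono: "X \<subseteq>\<^sub>m Y \<Longrightarrow> X(n \<mapsto> 0) \<subseteq>\<^sub>m Y(n \<mapsto> 0)"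
  by (auto simp: map_le_def)

lemma signed_Suc: "X \<in> signed p n \<Longrightarrow> X \<in> signed p (Suc n)"
  by (auto simp: signed_def)

lemma flag_cone:
  assumes "flag p n l" "0 < p"
  shows "flag p (Suc n) ([n \<mapsto> 0] # map (\<lambda>X. X(n \<mapsto> 0)) l)"
proof -
  have "sorted_wrt (\<subseteq>\<^sub>m) (map (\<lambda>X. X(n \<mapsto> 0)) l)"
    using assms unfolding sorted_wrt_map flag_def
    by (auto intro: sorted_wrt_mono_rel[of l "(\<subseteq>\<^sub>m)"] upd_mono)
  moreover have "[n \<mapsto> 0] \<subseteq>\<^sub>m X(n \<mapsto> 0)" for X :: "nat \<rightharpoonup> nat"
    by (simp add: map_le_def)
  ultimately show ?thesis
    using assms upd_signed[of _ p n] by (auto simp: flag_def subset_iff)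
qed

text \<open>Setting the new coordinate \<open>n\<close> to 0 preserves the order and moves every
  vector up, so a chain may switch to the extended vectors at \<open>x\<close>.\<close>

lemma flag_prism:
  assumes "flag p n (ys @ x # zs)" "0 < p"
  shows "flag p (Suc n) (ys @ x # map (\<lambda>X. X(n \<mapsto> 0)) (x # zs))"
proof -
  have sg: "set ys \<subseteq> signed p n" "x \<in> signed p n" "set zs \<subseteq> signed p n"
    using assms by (auto simp: flag_def)
  have "set (x # zs) \<subseteq> signed p n" using sg by auto
  then have below: "X \<subseteq>\<^sub>m Z(n \<mapsto> 0)" if "X \<subseteq>\<^sub>m Z" "Z \<in> set (x # zs)" for X Z
    using le_upd[of Z p n] that map_le_trans by blast
  have "sorted_wrt (\<subseteq>\<^sub>m) (map (\<lambda>X. X(n \<mapsto> 0)) (x # zs))"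
    using assms unfolding sorted_wrt_map
    by (auto simp: flag_def sorted_wrt_append upd_mono intro: sorted_wrt_mono_rel[of zs "(\<subseteq>\<^sub>m)"])
  then show ?thesis
    using assms below sg
    by (auto simp: flag_def sorted_wrt_append signed_Suc upd_signed subset_iff)
qed

text \<open>Pairing of a cochain with the chain $e_d$, where $e_{d+1}$ is the cone over the cycle
  $(\tau - 1) e_d$ or $(1 + \tau + \dots + \tau^{p-1}) e_d$ with apex in the new coordinate.\<close>

primrec cell :: "nat \<Rightarrow> nat \<Rightarrow> ((nat \<rightharpoonup> nat) list \<Rightarrow> int) \<Rightarrow> int" where
  "cell p 0 f = f [[0 \<mapsto> 0]]"
| "cell p (Suc d) f =
    cell p d (alternate (rotate_map p) p d (cone [Suc d \<mapsto> 0] (\<lambda>X. X(Suc d \<mapsto> 0)) f))"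

lemma cell_diff: "cell p d (\<lambda>l. f l - g l) = cell p d f - cell p d g"
proof (induction d arbitrary: f g)
  case (Suc d)
  have "cell p (Suc d) (\<lambda>l. f l - g l) = 
    cell p d (alternate (rotate_map p) p d (\<lambda>l. cone [Suc d \<mapsto> 0] (\<lambda>X. X(Suc d \<mapsto> 0)) f l
     - cone [Suc d \<mapsto> 0] (\<lambda>X. X(Suc d \<mapsto> 0)) g l))"
    by (simp add: cone_diff[abs_def])
  then show ?case unfolding alternate_diff[abs_def] Suc.IH by simp
qed simp

text \<open>\<open>cell p d\<close> evaluates its argument only at flags of \<open>Suc d\<close>
  vectors on \<open>Suc d\<close> coordinates. The case \<open>q = 0\<close> gives equality.\<close>

lemma cell_dvd:
  fixes q :: int
  assumes "\<And>l. flag p (Suc d) l \<Longrightarrow> length l = Suc d \<Longrightarrow> q dvd f l - g l" and "0 < p"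
  shows "q dvd cell p d f - cell p d g"
  using assms(1)
proof (induction d arbitrary: f g)
  case 0
  have "flag p (Suc 0) [[0 \<mapsto> 0]]"
    using upd_signed[of Map.empty p 0] \<open>0 < p\<close> by (simp add: flag_def)
  then show ?case using 0 by simp
next
  case (Suc d)
  let ?s = "\<lambda>X. X(Suc d \<mapsto> 0)" and ?v = "[Suc d \<mapsto> 0]"
  have cone: "q dvd cone ?v ?s f l - cone ?v ?s g l"
    if "flag p (Suc d) l" "length l = Suc d" for l
  proof -
    have "q dvd prism ?s f l - prism ?s g l"
    proof (rule prism_dvd)
      fix ys x zs assume "l = ys @ x # zs"
      then show "q dvd f (ys @ x # map ?s (x # zs)) - g (ys @ x # map ?s (x # zs))"
        using flag_prism[of p "Suc d" ys x zs] that \<open>0 < p\<close> by (intro Suc.prems) auto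
    qed
    moreover have "q dvd f (?v # map ?s l) - g (?v # map ?s l)"
      using that \<open>0 < p\<close> by (intro Suc.prems flag_cone) auto
    ultimately have "q dvd (f (?v # map ?s l) - g (?v # map ?s l))
        - (prism ?s f l - prism ?s g l)"
      by (rule dvd_diff[rotated])
    then show ?thesis by (simp add: cone_def algebra_simps)
  qed
  show ?case unfolding cell.simps
  proof (rule Suc.IH)
    fix l assume l: "flag p (Suc d) l" "length l = Suc d"
    show "q dvd alternate (rotate_map p) p d (cone ?v ?s f) l
        - alternate (rotate_map p) p d (cone ?v ?s g) l"
      unfolding alternate_diff[symmetric]
      using l \<open>0 < p\<close> by (auto simp: alternate_def intro!: dvd_diff dvd_sum cone flag_rotate flag_rotate_funpow)
  qed
qed

text \<open>The base of the cone defining the next chain is a cycle, so the boundary of that cone is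
  the base itself.\<close>

lemma cell_cobd:
  assumes "0 < p"
  shows "cell p (Suc d) (cobd f) = cell p d (alternate (rotate_map p) p d f)"
proof (induction d arbitrary: f)
  case 0
  let ?h = "cone [Suc 0 \<mapsto> 0] (\<lambda>X. X(Suc 0 \<mapsto> 0)) f"
  have "cell p (Suc 0) (cobd f) = cell p 0 (alternate (rotate_map p) p 0 f)
      - cell p 0 (cobd (alternate (rotate_map p) p 0 ?h))"
    unfolding cell.simps(2) cone_cobd[abs_def] alternate_diff[abs_def] cell_diff alternate_cobd[symmetric] ..
  \<comment> \<open>The remaining term applies \<tau> - 1 at the empty list, which \<tau>
    fixes.\<close>
  then show ?case by (simp add: alternate_def)
next
  case (Suc d)
  let ?h = "cone [Suc (Suc d) \<mapsto> 0] (\<lambda>X. X(Suc (Suc d) \<mapsto> 0)) f"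
  let ?D = "alternate (rotate_map p) p"
  have "cell p (Suc (Suc d)) (cobd f) = cell p (Suc d) (?D (Suc d) f)
      - cell p (Suc d) (cobd (?D (Suc d) ?h))"
    unfolding cell.simps(2)[of p "Suc d"] cone_cobd[abs_def] alternate_diff[abs_def] cell_diff alternate_cobd[symmetric] ..
  also have "cell p (Suc d) (cobd (?D (Suc d) ?h)) = cell p d (?D d (?D (Suc d) ?h))"
    by (rule Suc.IH)
  \<comment> \<open>Divisibility by 0 turns \<open>cell_dvd\<close> into an equality, and on flags
    the two operators compose to zero.\<close>
  also have "0 dvd cell p d (?D d (?D (Suc d) ?h)) - cell p d (\<lambda>l. 0 - 0)"
    using assms by (intro cell_dvd) (auto simp: alternate_alternate flag_period)
  then have "cell p d (?D d (?D (Suc d) ?h)) = 0"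
    unfolding cell_diff by simp
  finally show ?case by simp
qed

section \<open>The Tucker lemma for cyclic groups\<close>

text \<open>
  The carry of addition modulo $p$ is an invariant 2-cocycle generating the cohomology of
  $\mathbb{Z}_p$ in degree two, and wrap is a non-invariant primitive of it. All sign cochains are
  cup products of the sign itself or of wrap with powers of the carry.
\<close>

definition wrap :: "nat \<Rightarrow> nat \<Rightarrow> int" where
  "wrap a b = of_bool (b < a)"

definition carry :: "nat \<Rightarrow> nat \<Rightarrow> nat \<Rightarrow> int" where
  "carry a b c = wrap a b + wrap b c - wrap a c"

text \<open>Successive triples share an endpoint, as in a cup power of \<open>carry\<close>; a list
  of length \<open>2 * m + 1\<close> gives the power \<open>m\<close>.\<close>

fun carries :: "nat list \<Rightarrow> int" where
  "carries (a # b # c # l) = carry a b c * carries (c # l)"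
| "carries l = 1"

fun even_cochain :: "(nat \<Rightarrow> int) \<Rightarrow> nat list \<Rightarrow> int" where
  "even_cochain f [] = 0"
| "even_cochain f (a # l) = f a * carries (a # l)"

fun odd_cochain :: "nat list \<Rightarrow> int" where
  "odd_cochain [] = 0"
| "odd_cochain (a # l) = even_cochain (wrap a) l"

definition sign_cochain :: "nat \<Rightarrow> nat list \<Rightarrow> int" where
  "sign_cochain d = (if even d then even_cochain int else odd_cochain)"

text \<open>Since \<open>carry\<close> is a cocycle, only the coboundary of \<open>f\<close>
  survives. \<open>f\<close> is arbitrary because the induction uses \<open>carry a b\<close> in its
  place.\<close>

lemma cobd_even_cochain:
  "even (length l) \<Longrightarrow> cobd (even_cochain f) (a # b # l) = (f b - f a) * carries (b # l)"
proof (induction l arbitrary: f a b rule: induct_list012)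
  case (3 c d l)
  have 1: "cobd (\<lambda>xs. even_cochain f (a # b # xs)) (c # d # l)
      = f a * cobd (even_cochain (carry a b)) (c # d # l)"
    unfolding cobd_cmult[symmetric] by (rule cobd_cong) (auto simp: length_Suc_conv)
  have 2: "cobd (even_cochain (carry a b)) (c # d # l)
      = (carry a b d - carry a b c) * carries (d # l)"
    using 3 by auto
  have "cobd (even_cochain f) (a # b # c # d # l) =
      even_cochain f (b # c # d # l) - (even_cochain f (a # c # d # l)
        - cobd (\<lambda>xs. even_cochain f (a # b # xs)) (c # d # l))"
    by (simp only: cobd.simps)
  also have "\<dots> = (f b * carry b c d - f a * carry a c d
      + f a * (carry a b d - carry a b c)) * carries (d # l)"
    unfolding 1 2 by (simp add: algebra_simps)
  \<comment> \<open>This is the cocycle identity of \<open>carry\<close>, multiplied by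
    \<open>f a\<close>.\<close>
  also have "f b * carry b c d - f a * carry a c d + f a * (carry a b d - carry a b c)
      = (f b - f a) * carry b c d"
    by (simp add: carry_def algebra_simps)
  finally show ?case by (simp add: algebra_simps)
qed auto

text \<open>The coboundary of \<open>wrap\<close> is \<open>carry\<close>, which supplies one more
  factor of the cup power.\<close>

lemma cobd_odd_cochain:
  assumes "even (length l)"
  shows "cobd odd_cochain (a # b # c # l) = carries (a # b # c # l)"
proof -
  have "cobd odd_cochain (a # b # c # l)
      = odd_cochain (b # c # l) - cobd (\<lambda>xs. odd_cochain (a # xs)) (b # c # l)"
    by (simp only: cobd.simps)
  also have "(\<lambda>xs. odd_cochain (a # xs)) = even_cochain (wrap a)"
    by (rule ext) simp
  finally show ?thesis
    unfolding cobd_even_cochain[OF assms] by (simp add: carry_def algebra_simps)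
qed

section \<open>Cyclic shifts of the sign cochains\<close>

lemma wrap_mod:
  assumes "a < p" "b < p"
  shows "int p * wrap a b = (int b - int a) mod int p - (int b - int a)"
proof (cases "b < a")
  case True
  have "(int b - int a) mod int p = (int b - int a + int p) mod int p" by simp
  also have "\<dots> = int b - int a + int p" using assms True by (intro mod_pos_pos_trivial) auto
  finally show ?thesis using True by (simp add: wrap_def)
next
  case False
  then have "(int b - int a) mod int p = int b - int a" using assms by (intro mod_pos_pos_trivial) auto
  then show ?thesis using False by (simp add: wrap_def)
qed

lemma carry_mod:
  assumes "a < p" "b < p" "c < p"
  shows "int p * carry a b c = (int b - int a) mod int p + (int c - int b) mod int p
    - (int c - int a) mod int p"
  using wrap_mod[of a p b] wrap_mod[of b p c] wrap_mod[of a p c] assms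
  by (simp add: carry_def algebra_simps)

lemma diff_shift_mod:
  "(int ((b + t) mod p) - int ((a + t) mod p)) mod int p = (int b - int a) mod int p"
proof -
  have "(int ((b + t) mod p) - int ((a + t) mod p)) mod int p
      = ((int b + int t) - (int a + int t)) mod int p"
    unfolding zmod_int mod_diff_eq of_nat_add ..
  then show ?thesis by simp
qed

text \<open>By \<open>carry_mod\<close>, the carry depends only on differences modulo
  \<open>p\<close>, which a common shift preserves.\<close>

lemma carry_shift:
  assumes "a < p" "b < p" "c < p"
  shows "carry ((a + t) mod p) ((b + t) mod p) ((c + t) mod p) = carry a b c"
proof -
  have "int p * carry ((a + t) mod p) ((b + t) mod p) ((c + t) mod p) = int p * carry a b c"
    using assms by (subst (1 2) carry_mod) (auto simp: diff_shift_mod)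
  then show ?thesis using assms by simp
qed

lemma carries_shift:
  "set l \<subseteq> {..<p} \<Longrightarrow> carries (map (\<lambda>g. (g + t) mod p) l) = carries l"
  by (induction l rule: carries.induct) (auto simp: carry_shift)

lemma sum_shift:
  fixes f :: "nat \<Rightarrow> int"
  shows "(\<Sum>t<p. f ((a + t) mod p)) = (\<Sum>t<p. f (t mod p))"
proof (induction a)
  case (Suc a)
  have "(\<Sum>t<p. f ((a + Suc t) mod p) - f ((a + t) mod p)) = f ((a + p) mod p) - f ((a + 0) mod p)"
    by (rule sum_lessThan_telescope)
  then show ?case using Suc by (simp add: sum_subtractf)
qed simp

text \<open>By \<open>wrap_mod\<close>, \<open>p * wrap\<close> is a shift-invariant residue minus a
  difference that sums to zero over a full period.\<close>

lemma sum_wrap_shift: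
  assumes "a < p" "b < p"
  shows "(\<Sum>t<p. wrap ((a + t) mod p) ((b + t) mod p)) = (int b - int a) mod int p"
proof -
  have "int p * (\<Sum>t<p. wrap ((a + t) mod p) ((b + t) mod p))
     = (\<Sum>t<p. (int b - int a) mod int p - (int ((b + t) mod p) - int ((a + t) mod p)))"
    unfolding sum_distrib_left using assms
    by (intro sum.cong refl) (subst wrap_mod, auto simp: diff_shift_mod)
  also have "\<dots> = int p * ((int b - int a) mod int p)"
    by (simp add: sum_subtractf sum_shift[of int])
  finally show ?thesis using assms by simp
qed

lemma dvd_int_mod_diff: "int p dvd int (a mod p) - int a"
  by (simp add: zmod_int mod_eq_dvd_iff[symmetric])

text \<open>Summing over all shifts turns \<open>wrap a b\<close> into \<open>b - a\<close> modulo
  \<open>p\<close>, the coboundary of \<open>int\<close>, while \<open>carries\<close> is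
  invariant.\<close>

lemma sign_cochain_odd_step:
  assumes "even d" "length l = d + 2" "set l \<subseteq> {..<p}"
  shows "int p dvd (\<Sum>t<p. sign_cochain (Suc d) (map (\<lambda>g. (g + t) mod p) l)) - cobd (sign_cochain d) l"
proof -
  obtain a b m where l: "l = a # b # m" using assms by (auto simp: length_Suc_conv)
  have lt: "a < p" "b < p" "set (b # m) \<subseteq> {..<p}" using assms l by auto
  have "(\<Sum>t<p. sign_cochain (Suc d) (map (\<lambda>g. (g + t) mod p) l))
      = (\<Sum>t<p. wrap ((a + t) mod p) ((b + t) mod p) * carries (map (\<lambda>g. (g + t) mod p) (b # m)))"
    using assms(1) by (simp add: sign_cochain_def l)
  also have "\<dots> = (int b - int a) mod int p * carries (b # m)"
    unfolding carries_shift[OF lt(3)] sum_distrib_right[symmetric] sum_wrap_shift[OF lt(1,2)] ..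
  finally have "(\<Sum>t<p. sign_cochain (Suc d) (map (\<lambda>g. (g + t) mod p) l)) - cobd (sign_cochain d) l
      = ((int b - int a) mod int p - (int b - int a)) * carries (b # m)"
    using assms by (simp add: sign_cochain_def l cobd_even_cochain left_diff_distrib del: cobd.simps)
  also have "int p dvd \<dots>"
    by (intro dvd_mult2) (simp add: mod_eq_dvd_iff[symmetric])
  finally show ?thesis .
qed

text \<open>A shift by one raises the leading factor by 1 modulo \<open>p\<close>; what remains is
  \<open>carries\<close>, the coboundary of the odd cochain.\<close>

lemma sign_cochain_even_step:
  assumes "odd d" "length l = d + 2" "set l \<subseteq> {..<p}"
  shows "int p dvd sign_cochain (Suc d) (map (\<lambda>g. (g + 1) mod p) l) - sign_cochain (Suc d) l
    - cobd (sign_cochain d) l"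
proof -
  obtain e where "d = Suc e" using assms(1) by (cases d) auto
  then obtain a b c m where l: "l = a # b # c # m" using assms by (auto simp: length_Suc_conv)
  have ev: "even (length m)" using assms l by auto
  have "carries (map (\<lambda>g. (g + 1) mod p) l) = carries l" by (rule carries_shift[OF assms(3)])
  then have "sign_cochain (Suc d) (map (\<lambda>g. (g + 1) mod p) l) - sign_cochain (Suc d) l
      - cobd (sign_cochain d) l = (int ((a + 1) mod p) - int (a + 1)) * carries l"
    using assms(1) by (simp add: sign_cochain_def l cobd_odd_cochain[OF ev] algebra_simps del: cobd.simps carries.simps)
  also have "int p dvd \<dots>"
    by (intro dvd_mult2 dvd_int_mod_diff)
  finally show ?thesis .
qed

text \<open>For odd length the triples cover every adjacent pair, and \<open>carry\<close> vanishes
  when two neighbouring arguments agree.\<close>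

lemma carries_degenerate: "odd (length l) \<Longrightarrow> \<not> distinct_adj l \<Longrightarrow> carries l = 0"
  by (induction l rule: carries.induct) (auto simp: carry_def wrap_def)

lemma sign_cochain_degenerate:
  assumes "length l = Suc d" "\<not> distinct_adj l"
  shows "sign_cochain d l = 0"
proof (cases "even d")
  case True
  then show ?thesis using assms carries_degenerate[of l] by (cases l) (auto simp: sign_cochain_def)
next
  case False
  then obtain a b m where l: "l = a # b # m" using assms by (cases d) (auto simp: length_Suc_conv)
  then show ?thesis
    using False assms carries_degenerate[of "b # m"] by (auto simp: sign_cochain_def wrap_def)
qed

lemma signed_mono: "m \<le> n \<Longrightarrow> signed p m \<subseteq> signed p n"
  by (auto simp: signed_def)

section \<open>Pairing argument for the Tucker lemma\<close>

theorem Zp_tucker: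
  fixes sgn lev :: "(nat \<rightharpoonup> nat) \<Rightarrow> nat"
  assumes p: "2 \<le> p"
    and sgn: "\<And>X. X \<in> signed p n \<Longrightarrow> sgn X < p"
    and equivariant: "\<And>X. X \<in> signed p n \<Longrightarrow> sgn (rotate_map p X) = Suc (sgn X) mod p"
    and mono: "\<And>X Y. X \<in> signed p n \<Longrightarrow> Y \<in> signed p n \<Longrightarrow> X \<subseteq>\<^sub>m Y \<Longrightarrow> lev X \<le> lev Y"
    and const: "\<And>X Y. X \<in> signed p n \<Longrightarrow> Y \<in> signed p n \<Longrightarrow> X \<subseteq>\<^sub>m Y \<Longrightarrow> lev X = lev Y \<Longrightarrow> sgn X = sgn Y"
    and lev: "\<And>X. X \<in> signed p n \<Longrightarrow> lev X < N"
  shows "n \<le> N"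
proof (rule ccontr)
  assume "\<not> n \<le> N"
  let ?f = "\<lambda>d l. sign_cochain d (map sgn l)"
  let ?D = "alternate (rotate_map p) p"
  have p0: "0 < p" using p by simp
  have sgn_pow: "sgn ((rotate_map p ^^ t) X) = (sgn X + t) mod p" if "X \<in> signed p n" for X t
  proof (induction t)
    case 0
    then show ?case using sgn[OF that] by simp
  next
    case (Suc t)
    have "(rotate_map p ^^ t) X \<in> signed p n"
      by (induction t) (auto simp: that rotate_map_signed p0)
    then show ?case using equivariant Suc by (simp add: mod_Suc_eq)
  qed
  have map_pow: "map sgn (map (rotate_map p ^^ t) l) = map (\<lambda>g. (g + t) mod p) (map sgn l)"
    if "set l \<subseteq> signed p n" for l t
    using that sgn_pow by auto
  have inn: "set l \<subseteq> signed p n" if "flag p (Suc d) l" "d < n" for d l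
    using that signed_mono[of "Suc d" n p] by (auto simp: flag_def)
  \<comment> \<open>The operator applied to the next sign cochain is congruent to the coboundary of
    the current one, and \<open>cell_cobd\<close> moves that coboundary down one dimension.\<close>
  have "int p dvd cell p d (?D d (?f d)) - 1" if "d < n" for d
    using that
  proof (induction d)
    case 0
    let ?v = "[0 \<mapsto> 0] :: nat \<rightharpoonup> nat"
    have "?v \<in> signed p n" using upd_signed[of Map.empty p 0] p0 signed_mono[of "Suc 0" n p] 0 by auto
    then have "cell p 0 (?D 0 (?f 0)) - 1 = int (Suc (sgn ?v) mod p) - int (Suc (sgn ?v))"
      using equivariant by (simp add: alternate_def sign_cochain_def)
    then show ?case by (simp only: dvd_int_mod_diff)
  next
    case (Suc d)
    have "int p dvd cell p (Suc d) (?D (Suc d) (?f (Suc d))) - cell p (Suc d) (cobd (?f d))"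
    proof (rule cell_dvd[OF _ p0])
      fix l assume l: "flag p (Suc (Suc d)) l" "length l = Suc (Suc d)"
      have sl: "set l \<subseteq> signed p n" using inn[OF l(1)] Suc.prems by simp
      then have "set (map sgn l) \<subseteq> {..<p}" using sgn by auto
      moreover have "cobd (?f d) l = cobd (sign_cochain d) (map sgn l)" by (simp add: cobd_map)
      moreover have "map sgn (map (rotate_map p) l) = map (\<lambda>g. (g + 1) mod p) (map sgn l)"
        using map_pow[OF sl, of 1] by simp
      ultimately show "int p dvd ?D (Suc d) (?f (Suc d)) l - cobd (?f d) l"
        using sign_cochain_odd_step[of d "map sgn l" p] sign_cochain_even_step[of d "map sgn l" p] l(2)
        by (cases "even d") (simp_all add: alternate_def map_pow[OF sl] del: map_map)
    qed
    moreover have "int p dvd cell p (Suc d) (cobd (?f d)) - 1"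
      unfolding cell_cobd[OF p0] using Suc by simp
    ultimately show ?case by (metis (no_types, lifting) diff_add_cancel dvd_add add_diff_eq)
  qed
  then have 1: "int p dvd cell p N (?D N (?f N)) - 1" using \<open>\<not> n \<le> N\<close> by simp
  have degenerate: "?f N l = 0" if "flag p (Suc N) l" "length l = Suc N" for l
  proof (rule sign_cochain_degenerate)
    have sl: "set l \<subseteq> signed p n" using inn[OF that(1)] \<open>\<not> n \<le> N\<close> by simp
    show "\<not> distinct_adj (map sgn l)"
    proof
      assume adj: "distinct_adj (map sgn l)"
      \<comment> \<open>Each sign change strictly raises the level, so the last of
        \<open>N + 1\<close> vectors would have level at least \<open>N\<close>.\<close>
      have "i \<le> lev (l ! i)" if "i \<le> N" for i
        using that
      proof (induction i)
        case (Suc i)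
        have "l ! i \<in> signed p n" "l ! Suc i \<in> signed p n"
          using sl Suc.prems \<open>length l = Suc N\<close> by (auto intro: nth_mem)
        moreover have "l ! i \<subseteq>\<^sub>m l ! Suc i"
          using \<open>flag p (Suc N) l\<close> Suc.prems \<open>length l = Suc N\<close>
          by (auto simp: flag_def sorted_wrt_iff_nth_less)
        moreover have "sgn (l ! i) \<noteq> sgn (l ! Suc i)"
          using adj Suc.prems \<open>length l = Suc N\<close> by (auto simp: distinct_adj_conv_nth)
        ultimately have "lev (l ! i) < lev (l ! Suc i)"
          using mono const by (metis le_neq_implies_less)
        then show ?case using Suc by simp
      qed simp
      moreover have "l ! N \<in> signed p n" using sl \<open>length l = Suc N\<close> by (auto intro: nth_mem)
      ultimately show False using lev by (meson leD order_refl)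
    qed
  qed (use that in simp)
  have "int p dvd cell p N (?D N (?f N)) - cell p N (\<lambda>l. 0 - 0)"
  proof (rule cell_dvd[OF _ p0])
    fix l assume l: "flag p (Suc N) l" "length l = Suc N"
    then show "int p dvd ?D N (?f N) l - (0 - 0)"
      using flag_rotate[OF l(1) p0] flag_rotate_funpow[OF l(1) p0] degenerate
      by (simp add: alternate_def del: map_map)
  qed
  then have "int p dvd cell p N (?D N (?f N))" unfolding cell_diff by simp
  with 1 have "int p dvd 1" by (metis dvd_diff_right_iff)
  then show False using p by simp
qed

section \<open>Balanced monochromatic families\<close>

lemma bij_betw_Suc_mod: "0 < p \<Longrightarrow> bij_betw (\<lambda>g. Suc g mod p) {..<p} {..<p}"
  by (rule bij_betwI[where g = "\<lambda>g. (g + p - 1) mod p"]) (auto simp: mod_Suc mod_if)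

text \<open>The center of $G$ is its mean in $\mathbb{Z}_p$; this is the only place where $p$ must be prime.\<close>

lemma ex_equivariant_center:
  assumes "prime p"
  obtains center :: "nat set \<Rightarrow> nat" where
    "\<And>G. center G < p"
    "\<And>G. G \<subset> {..<p} \<Longrightarrow> G \<noteq> {} \<Longrightarrow> center ((\<lambda>g. Suc g mod p) ` G) = Suc (center G) mod p"
proof -
  \<comment> \<open>\<open>u a\<close> inverts \<open>a\<close> modulo \<open>p\<close>; it is
    applied to \<open>card G\<close>, which lies strictly between 0 and \<open>p\<close>.\<close>
  have "\<exists>u. 0 < a \<and> a < p \<longrightarrow> [a * u = 1] (mod p)" for a
    using cong_solve_coprime_nat[of a p] prime_imp_coprime[OF assms, of a] nat_dvd_not_less[of a p]
    by (auto simp: coprime_commute)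
  then obtain u where u: "\<And>a. 0 < a \<Longrightarrow> a < p \<Longrightarrow> [a * u a = 1] (mod p)" by metis
  let ?center = "\<lambda>G. (u (card G) * \<Sum>G) mod p"
  show ?thesis
  proof
    show "?center G < p" for G using prime_gt_0_nat[OF assms] by simp
    fix G assume G: "G \<subset> {..<p}" "G \<noteq> {}"
    have inj: "inj_on (\<lambda>g. Suc g mod p) G"
      using bij_betw_Suc_mod[OF prime_gt_0_nat[OF assms]] G(1)
      by (meson bij_betw_def inj_on_subset psubset_imp_subset)
    have fin: "finite G" using G(1) finite_subset by blast
    have "card G < card {..<p}" by (rule psubset_card_mono) (use G in auto)
    then have c: "0 < card G" "card G < p" using G fin by auto
    have "[u (card G) * (\<Sum>g\<in>G. Suc g mod p) = u (card G) * (\<Sum>g\<in>G. Suc g)] (mod p)"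
      by (intro cong_mult cong_sum) (auto simp: cong_def)
    also have "u (card G) * (\<Sum>g\<in>G. Suc g) = u (card G) * \<Sum>G + card G * u (card G)"
      by (simp add: sum_Suc algebra_simps)
    also have "[\<dots> = u (card G) * \<Sum>G + 1] (mod p)"
      by (intro cong_add u c) simp
    finally show "?center ((\<lambda>g. Suc g mod p) ` G) = Suc (?center G) mod p"
      by (simp add: card_image[OF inj] sum.reindex[OF inj] cong_def mod_Suc_eq)
  qed
qed

text \<open>The capacity \<open>b\<close> varies with the point because in the composite case it
  counts the clones of that point in a given set.\<close>

definition balanced_family ::
  "('a set \<Rightarrow> 'c) \<Rightarrow> 'a set \<Rightarrow> nat \<Rightarrow> nat \<Rightarrow> ('a \<Rightarrow> nat) \<Rightarrow> (nat \<Rightarrow> 'a set) \<Rightarrow> bool" where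
  "balanced_family c V k r b A \<longleftrightarrow>
    (\<forall>i<r. A i \<in> nsets V k) \<and> (\<forall>i<r. \<forall>j<r. c (A i) = c (A j)) \<and>
    (\<forall>x\<in>V. card {i. i < r \<and> x \<in> A i} \<le> b x)"

lemma balanced_familyD:
  assumes "balanced_family c V k r b A"
  shows "i < r \<Longrightarrow> A i \<in> nsets V k"
    and "i < r \<Longrightarrow> j < r \<Longrightarrow> c (A i) = c (A j)"
    and "x \<in> V \<Longrightarrow> card {i. i < r \<and> x \<in> A i} \<le> b x"
  using assms unfolding balanced_family_def by blast+

lemma balanced_family_prime_lt:
  fixes V :: "'a set" and c :: "'a set \<Rightarrow> 'c"
  assumes p: "prime p" and V: "finite V" and b: "\<forall>x\<in>V. b x < p" and C: "finite C"
    and c: "c \<in> nsets V k \<rightarrow> C" and k: "1 \<le> k"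
    and big: "card C * (p - 1) + p * (k - 1) < sum b V"
  shows "\<exists>A. balanced_family c V k p b A"
proof (rule ccontr)
  assume no: "\<not> ?thesis"
  define n where "n = sum b V"
  let ?S = "SIGMA x:V. {..<b x}" and ?suc = "\<lambda>g. Suc g mod p"
  have p0: "0 < p" and p2: "2 \<le> p" using p by (auto simp: prime_gt_0_nat prime_ge_2_nat)
  have "card ?S = n" by (simp add: V n_def)
  moreover have "finite ?S" using V by auto
  ultimately obtain e where e: "bij_betw e {..<n} ?S"
    by (metis ex_bij_betw_nat_finite atLeast0LessThan)
  define \<pi> where "\<pi> i = fst (e i)" for i
  define A where "A X g = \<pi> ` {i. X i = Some g}" for X :: "nat \<rightharpoonup> nat" and g
  \<comment> \<open>\<open>G X x\<close> and \<open>F X j\<close> are sets of labels that rotation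
    shifts cyclically; when nonempty and proper they have a center.\<close>
  define G where "G X x = {g. x \<in> A X g}" for X x
  define F where "F X j = {g. g < p \<and> (\<exists>B\<in>nsets (A X g) k. c B = j)}" for X j
  have e_in: "\<pi> i \<in> V \<and> e i \<in> {\<pi> i} \<times> {..<b (\<pi> i)}" if "i < n" for i
  proof -
    have "e i \<in> ?S" using bij_betwE[OF e] that by blast
    then show ?thesis by (cases "e i") (auto simp: \<pi>_def)
  qed
  have X_lt: "i < n \<and> g < p" if "X \<in> signed p n" "X i = Some g" for X i g
    using that by (auto simp: signed_def ran_def dom_def)
  have A_V: "A X g \<subseteq> V" if "X \<in> signed p n" for X g
    using X_lt[OF that] e_in by (auto simp: A_def)
  have A_fin: "finite (A X g)" if "X \<in> signed p n" for X g
    using A_V[OF that] V finite_subset by blast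
  have G_lt: "G X x \<subseteq> {..<p}" if "X \<in> signed p n" for X x
    using X_lt[OF that] by (auto simp: A_def G_def)
  have G_card: "card (G X x) \<le> b x" if "X \<in> signed p n" for X x
  proof -
    let ?I = "{i. i < n \<and> \<pi> i = x}"
    have "G X x \<subseteq> (\<lambda>i. the (X i)) ` ?I"
      using X_lt[OF that] by (force simp: G_def A_def)
    then have "card (G X x) \<le> card ?I" by (rule surj_card_le[rotated]) simp
    also have "card ?I \<le> card ({x} \<times> {..<b x})"
    proof (rule card_inj_on_le)
      show "inj_on e ?I" using e by (auto simp: bij_betw_def intro: inj_on_subset)
      show "e ` ?I \<subseteq> {x} \<times> {..<b x}" using e_in by blast
    qed auto
    finally show ?thesis by simp
  qed
  \<comment> \<open>If colour \<open>j\<close> occurred for every label, choosing one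
    \<open>k\<close>-set per label would give a balanced family.\<close>
  have F_lt: "F X j \<subset> {..<p}" if X: "X \<in> signed p n" for X j
  proof -
    have "F X j \<noteq> {..<p}"
    proof
      assume "F X j = {..<p}"
      then have "\<forall>g<p. \<exists>B. B \<in> nsets (A X g) k \<and> c B = j" by (auto simp: F_def)
      then obtain B where B: "\<And>g. g < p \<Longrightarrow> B g \<in> nsets (A X g) k \<and> c (B g) = j" by metis
      have "card {i. i < p \<and> x \<in> B i} \<le> b x" if "x \<in> V" for x
      proof -
        have "card {i. i < p \<and> x \<in> B i} \<le> card (G X x)"
        proof (rule card_mono)
          show "finite (G X x)" using G_lt[OF X] finite_subset by blast
          show "{i. i < p \<and> x \<in> B i} \<subseteq> G X x" using B by (force simp: G_def nsets_def)
        qed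
        then show ?thesis using G_card[OF X, of x] by simp
      qed
      moreover have "B i \<in> nsets V k" if "i < p" for i
        using B[OF that] A_V[OF X, of i] by (auto simp: nsets_def)
      ultimately have "balanced_family c V k p b B" using B by (auto simp: balanced_family_def)
      then show False using no by blast
    qed
    then show ?thesis by (auto simp: F_def)
  qed
  have G_proper: "G X x \<subset> {..<p}" if "X \<in> signed p n" "x \<in> V" for X x
  proof -
    have "card (G X x) < card {..<p}" using G_card[OF that(1), of x] b that(2) by (metis card_lessThan le_less_trans)
    then show ?thesis using G_lt[OF that(1), of x] by auto
  qed
  have bij: "bij_betw ?suc {..<p} {..<p}" by (rule bij_betw_Suc_mod[OF p0])
  have suc_inj: "?suc g = ?suc h \<longleftrightarrow> g = h" if "g < p" "h < p" for g h
    using inj_on_eq_iff[OF bij_betw_imp_inj_on[OF bij], of g h] that by simp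
  have eq_suc_image: "S = ?suc ` T"
    if "S \<subseteq> {..<p}" "T \<subseteq> {..<p}" "\<And>h. h < p \<Longrightarrow> ?suc h \<in> S \<longleftrightarrow> h \<in> T" for S T
  proof -
    have "S \<subseteq> ?suc ` {..<p}" using that(1) bij_betw_imp_surj_on[OF bij] by simp
    then show ?thesis using that(2,3) by blast
  qed
  have A_rot: "A (rotate_map p X) (?suc h) = A X h" if "X \<in> signed p n" "h < p" for X h
  proof -
    have "rotate_map p X i = Some (?suc h) \<longleftrightarrow> X i = Some h" for i
      using X_lt[OF that(1), of i] suc_inj that(2) by (auto simp: rotate_map_def)
    then show ?thesis by (simp add: A_def)
  qed
  have G_rot: "G (rotate_map p X) x = ?suc ` G X x" if X: "X \<in> signed p n" for X x
    by (rule eq_suc_image[OF G_lt[OF rotate_map_signed[OF X p0]] G_lt[OF X]])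
      (simp add: G_def A_rot[OF X])
  have F_rot: "F (rotate_map p X) j = ?suc ` F X j" if X: "X \<in> signed p n" for X j
    by (rule eq_suc_image) (auto simp: F_def A_rot[OF X] p0)
  obtain center where center: "\<And>G. center G < p"
    "\<And>G. G \<subset> {..<p} \<Longrightarrow> G \<noteq> {} \<Longrightarrow> center (?suc ` G) = Suc (center G) mod p"
    using ex_equivariant_center[OF p] by metis
  \<comment> \<open>The center of \<open>H X\<close> will be the sign; points are consulted only
    while no colour occurs. \<open>SOME\<close> depends only on which sets are empty, so it commutes
    with rotation.\<close>
  define H where "H X = (if \<exists>j\<in>C. F X j \<noteq> {} then F X (SOME j. j \<in> C \<and> F X j \<noteq> {})
    else G X (SOME x. x \<in> V \<and> G X x \<noteq> {}))" for X
  define size where "size X = (\<Sum>g<p. card (A X g))" for X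
  \<comment> \<open>By \<open>small\<close>, the cap on \<open>size\<close> is inactive while no
    colour occurs; afterwards the sets \<open>F X j\<close> determine the sign.\<close>
  define level where "level X = min (size X) (p * (k - 1)) + (\<Sum>j\<in>C. card (F X j))" for X
  have G_ex: "\<exists>x. x \<in> V \<and> G X x \<noteq> {}" if X: "X \<in> signed p n" for X
  proof -
    obtain i g where "X i = Some g" using X by (force simp: signed_def)
    then have "\<pi> i \<in> V" "g \<in> G X (\<pi> i)"
      using e_in X_lt[OF X] by (auto simp: G_def A_def)
    then show ?thesis by blast
  qed
  have H: "H X \<noteq> {} \<and> H X \<subset> {..<p}" if X: "X \<in> signed p n" for X
  proof (cases "\<exists>j\<in>C. F X j \<noteq> {}")
    case True
    then have "\<exists>j. j \<in> C \<and> F X j \<noteq> {}" by blast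
    from someI_ex[OF this] show ?thesis using F_lt[OF X] True by (simp add: H_def)
  next
    case False
    then show ?thesis using someI_ex[OF G_ex[OF X]] G_proper[OF X] by (auto simp: H_def)
  qed
  have H_rot: "H (rotate_map p X) = ?suc ` H X" if "X \<in> signed p n" for X
    unfolding H_def F_rot[OF that] G_rot[OF that] by simp
  have small: "size X \<le> p * (k - 1)" if X: "X \<in> signed p n" and empty: "\<forall>j\<in>C. F X j = {}" for X
  proof -
    have "card (A X g) \<le> k - 1" if "g < p" for g
    proof (rule ccontr)
      assume "\<not> card (A X g) \<le> k - 1"
      then have "k \<le> card (A X g)" by simp
      then obtain B where B: "B \<subseteq> A X g" "card B = k" "finite B"
        by (meson obtain_subset_with_card_n)
      then have "B \<in> nsets (A X g) k" "B \<in> nsets V k" using A_V[OF X, of g] by (auto simp: nsets_def)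
      then have "g \<in> F X (c B)" "c B \<in> C" using c that by (auto simp: F_def)
      then show False using empty by blast
    qed
    then have "size X \<le> (\<Sum>g<p. k - 1)" unfolding size_def by (intro sum_mono) auto
    then show ?thesis by simp
  qed
  have level_pos: "0 < level X" if X: "X \<in> signed p n" for X
  proof (cases "\<exists>j\<in>C. F X j \<noteq> {}")
    case True
    then obtain j where j: "j \<in> C" "F X j \<noteq> {}" by blast
    have "finite (F X j)" by (simp add: F_def)
    then have "0 < card (F X j)" using j by (simp add: card_gt_0_iff)
    also have "\<dots> \<le> (\<Sum>j\<in>C. card (F X j))" using C j by (intro member_le_sum) auto
    finally show ?thesis by (simp add: level_def)
  next
    case False
    obtain x g where "g \<in> G X x" using G_ex[OF X] by blast
    then have "g < p" "A X g \<noteq> {}" using G_lt[OF X, of x] by (auto simp: G_def)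
    then have "0 < card (A X g)" using A_fin[OF X, of g] by (simp add: card_gt_0_iff)
    also have "card (A X g) \<le> size X" unfolding size_def using \<open>g < p\<close> by (intro member_le_sum) auto
    finally show ?thesis using small[OF X] False by (simp add: level_def)
  qed
  have level_le: "level X \<le> card C * (p - 1) + p * (k - 1)" if X: "X \<in> signed p n" for X
  proof -
    have "card (F X j) \<le> p - 1" for j
      using psubset_card_mono[OF _ F_lt[OF X, of j]] by simp
    then have "(\<Sum>j\<in>C. card (F X j)) \<le> (\<Sum>j\<in>C. p - 1)" by (intro sum_mono)
    then show ?thesis by (simp add: level_def)
  qed
  have A_mono: "A X g \<subseteq> A Y g" if "X \<subseteq>\<^sub>m Y" for X Y g
  proof -
    have "{i. X i = Some g} \<subseteq> {i. Y i = Some g}" using that by (force simp: map_le_def dom_def)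
    then show ?thesis unfolding A_def by (rule image_mono)
  qed
  have F_mono: "F X j \<subseteq> F Y j" if "X \<subseteq>\<^sub>m Y" for X Y j
    unfolding F_def using nsets_mono[OF A_mono[OF that]] by blast
  have F_fin: "finite (F X j)" for X j by (simp add: F_def)
  have size_mono: "size X \<le> size Y" if "Y \<in> signed p n" "X \<subseteq>\<^sub>m Y" for X Y
    unfolding size_def by (intro sum_mono card_mono A_fin A_mono that)
  have F_sum_mono: "(\<Sum>j\<in>C. card (F X j)) \<le> (\<Sum>j\<in>C. card (F Y j))" if "X \<subseteq>\<^sub>m Y" for X Y
    by (intro sum_mono card_mono F_fin F_mono that)
  \<comment> \<open>Both summands of the level are monotone, so each is constant. Then all
    \<open>F\<close> agree, and if they are empty the sizes agree too, hence all labelled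
    sets.\<close>
  have H_const: "H X = H Y" if X: "X \<in> signed p n" and Y: "Y \<in> signed p n" and XY: "X \<subseteq>\<^sub>m Y"
    and eq: "level X = level Y" for X Y
  proof -
    have eqs: "(\<Sum>j\<in>C. card (F X j)) = (\<Sum>j\<in>C. card (F Y j))"
      "min (size X) (p * (k - 1)) = min (size Y) (p * (k - 1))"
      using eq F_sum_mono[OF XY] size_mono[OF Y XY] unfolding level_def by linarith+
    have FF: "F X j = F Y j" if "j \<in> C" for j
    proof (rule card_subset_eq[OF F_fin F_mono[OF XY]])
      show "card (F X j) = card (F Y j)"
        by (rule sum_mono_inv[OF eqs(1) _ that C]) (intro card_mono F_fin F_mono XY)
    qed
    show ?thesis
    proof (cases "\<exists>j\<in>C. F X j \<noteq> {}")
      case True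
      have "(\<lambda>j. j \<in> C \<and> F X j \<noteq> {}) = (\<lambda>j. j \<in> C \<and> F Y j \<noteq> {})" using FF by auto
      moreover have "(SOME j. j \<in> C \<and> F X j \<noteq> {}) \<in> C"
        using someI_ex[of "\<lambda>j. j \<in> C \<and> F X j \<noteq> {}"] True by blast
      ultimately show ?thesis using FF True by (simp add: H_def)
    next
      case False
      then have "size X = size Y"
        using eqs(2) small[OF X] small[OF Y] FF by auto
      then have sums: "(\<Sum>g<p. card (A X g)) = (\<Sum>g<p. card (A Y g))" by (simp add: size_def)
      have "A X g = A Y g" if "g < p" for g
      proof (rule card_subset_eq[OF A_fin[OF Y] A_mono[OF XY]])
        show "card (A X g) = card (A Y g)"
          by (rule sum_mono_inv[OF sums]) (use that card_mono[OF A_fin[OF Y] A_mono[OF XY]] in auto)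
      qed
      then have "G X x = G Y x" for x
        using G_lt[OF X, of x] G_lt[OF Y, of x] by (auto simp: G_def)
      then show ?thesis using False FF by (simp add: H_def)
    qed
  qed
  have "n \<le> card C * (p - 1) + p * (k - 1)"
  \<comment> \<open>Levels start at 1, so subtracting one loses nothing and makes the upper bound
    strict.\<close>
  proof (rule Zp_tucker[OF p2, where sgn = "\<lambda>X. center (H X)" and lev = "\<lambda>X. level X - 1"])
    fix X assume X: "X \<in> signed p n"
    show "center (H X) < p" by (rule center)
    show "center (H (rotate_map p X)) = Suc (center (H X)) mod p"
      using H_rot[OF X] center(2) H[OF X] by simp
    show "level X - 1 < card C * (p - 1) + p * (k - 1)"
      using level_pos[OF X] level_le[OF X] by linarith
    fix Y assume Y: "Y \<in> signed p n" and XY: "X \<subseteq>\<^sub>m Y"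
    have "level X \<le> level Y"
      unfolding level_def using F_sum_mono[OF XY] size_mono[OF Y XY] by linarith
    then show "level X - 1 \<le> level Y - 1" by simp
    show "center (H X) = center (H Y)" if "level X - 1 = level Y - 1"
      using H_const[OF X Y XY] that level_pos[OF X] level_pos[OF Y] by simp
  qed
  then show False using big n_def by simp
qed

lemma balanced_family_prime:
  fixes V :: "'a set" and c :: "'a set \<Rightarrow> 'c"
  assumes p: "prime p" and V: "finite V" and b: "\<forall>x\<in>V. b x \<le> p" and C: "finite C"
    and c: "c \<in> nsets V k \<rightarrow> C" and k: "1 \<le> k"
    and big: "card C * (p - 1) + p * (k - 1) < sum b V"
  shows "\<exists>A. balanced_family c V k p b A"
proof -
  define D where "D = {x \<in> V. b x = p}"
  have D: "D \<subseteq> V" "finite D" using V by (auto simp: D_def)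
  have full: "card {i. i < p \<and> P i} \<le> b x" if "x \<in> D" for P x
  proof -
    have "card {i. i < p \<and> P i} \<le> card {..<p}" by (intro card_mono) auto
    then show ?thesis using that by (simp add: D_def)
  qed
  show ?thesis
  proof (cases "k \<le> card D")
    \<comment> \<open>One \<open>k\<close>-set of points with full capacity can be repeated
      \<open>p\<close> times.\<close>
    case True
    then obtain B where B: "B \<subseteq> D" "card B = k" "finite B" by (meson obtain_subset_with_card_n)
    have "card {i. i < p \<and> x \<in> B} \<le> b x" for x
      using full[of x "\<lambda>_. x \<in> B"] B by (cases "x \<in> B") auto
    then have "balanced_family c V k p b (\<lambda>i. B)"
      using B D by (auto simp: balanced_family_def nsets_def)
    then show ?thesis by blast
  next
    case False
    let ?c = "\<lambda>B. c (B \<union> D)" and ?k = "k - card D"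
    have union: "B \<union> D \<in> nsets V k" if "B \<in> nsets (V - D) ?k" for B
    proof -
      have "card (B \<union> D) = card B + card D"
        using that D by (intro card_Un_disjoint) (auto simp: nsets_def)
      then show ?thesis using that D False by (auto simp: nsets_def)
    qed
    have "sum b V = sum b (V - D) + sum b D" by (rule sum.subset_diff[OF D(1) V])
    also have "sum b D = p * card D" by (simp add: D_def)
    finally have "card C * (p - 1) + p * (k - 1) < sum b (V - D) + p * card D" using big by simp
    \<comment> \<open>Removing \<open>D\<close> lowers the required bound and the total capacity by
      the same amount.\<close>
    moreover have "p * (k - 1) = p * (?k - 1) + p * card D"
      using False unfolding distrib_left[symmetric] by simp
    ultimately have "card C * (p - 1) + p * (?k - 1) < sum b (V - D)" by linarith
    moreover have "\<forall>x\<in>V - D. b x < p" using b by (auto simp: D_def le_less)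
    moreover have "?c \<in> nsets (V - D) ?k \<rightarrow> C" using union c by blast
    moreover have "1 \<le> ?k" using False by simp
    ultimately have "\<exists>A. balanced_family ?c (V - D) ?k p b A"
      using V C by (intro balanced_family_prime_lt[OF p]) auto
    then obtain A where A: "balanced_family ?c (V - D) ?k p b A" by blast
    have "card {i. i < p \<and> x \<in> A i \<union> D} \<le> b x" if "x \<in> V" for x
    proof (cases "x \<in> D")
      case False
      then show ?thesis using balanced_familyD(3)[OF A, of x] that by simp
    qed (rule full)
    then have "balanced_family c V k p b (\<lambda>i. A i \<union> D)"
      using balanced_familyD(1,2)[OF A] union unfolding balanced_family_def by blast
    then show ?thesis by blast
  qed
qed

section \<open>Composite numbers of sets\<close>

lemma sum_min_chunks: "(\<Sum>i<m. min p (a - i * p)) = min a (m * p)" for a p m :: nat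
  by (induction m) (auto simp: min_def)

lemma sum_lessThan_mult:
  "(\<Sum>i<m * n. f i) = (\<Sum>j<m. \<Sum>l<n. f (j * n + l))" for f :: "nat \<Rightarrow> nat"
proof -
  have "sum f {j * n..<j * n + n} = (\<Sum>l<n. f (j * n + l))" for j
    using sum.shift_bounds_nat_ivl[of f 0 "j * n" n] by (simp add: add.commute atLeast0LessThan)
  then show ?thesis by (simp add: sum.nat_group[symmetric])
qed

lemma card_lessThan_eq_sum: "card {i. i < m \<and> P i} = (\<Sum>i<m. of_bool (P i))" for m :: nat
proof -
  have "{i. i < m \<and> P i} = {..<m} \<inter> {i. P i}" by auto
  then show ?thesis by (simp add: sum_of_bool_eq)
qed

theorem balanced_family_exists:
  fixes V :: "'a set" and c :: "'a set \<Rightarrow> 'c"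
  assumes "1 \<le> r" and V: "finite V" and "\<forall>x\<in>V. b x \<le> r" and C: "finite C"
    and c: "c \<in> nsets V k \<rightarrow> C" and k: "1 \<le> k"
    and "card C * (r - 1) + r * (k - 1) < sum b V"
  shows "\<exists>A. balanced_family c V k r b A"
  using assms(1,3,7)
proof (induction r arbitrary: b rule: less_induct)
  case (less r)
  show ?case
  proof (cases "r = 1")
    case True
    let ?D = "{x \<in> V. b x \<noteq> 0}"
    have "sum b V = sum b ?D" by (rule sum.mono_neutral_right) (use V in auto)
    also have "\<dots> \<le> (\<Sum>x\<in>?D. 1)" using less.prems True by (intro sum_mono) auto
    finally have "k \<le> card ?D" using less.prems(3) True k by simp
    then obtain B where B: "B \<subseteq> ?D" "card B = k" "finite B" by (meson obtain_subset_with_card_n)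
    have "card {i. i < r \<and> x \<in> B} \<le> b x" for x
      using B True by (cases "x \<in> B") auto
    then have "balanced_family c V k r b (\<lambda>i. B)"
      using B by (auto simp: balanced_family_def nsets_def)
    then show ?thesis by blast
  next
    case False
    then obtain p where p: "prime p" "p dvd r" using prime_factor_nat by blast
    then obtain q where r: "r = p * q" by (auto simp: dvd_def)
    have "q \<noteq> 0" using r less.prems(1) by (metis mult_0_right not_one_le_zero)
    moreover have "1 < p" by (rule prime_gt_1_nat[OF p(1)])
    ultimately have q: "1 \<le> q" "q < r" and pos: "0 < p" "0 < q" unfolding r by simp_all
    \<comment> \<open>\<open>K - 1\<close> is the bound for \<open>q\<close>, so every set of
      \<open>K\<close> clones exceeds it; inserted into the bound for \<open>p\<close> it gives the
      bound for \<open>p * q\<close>.\<close>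
    define K where "K = Suc (card C * (q - 1) + q * (k - 1))"
    let ?W = "V \<times> {..<q}"
    define mult where "mult N x = card {i. i < q \<and> (x, i) \<in> N}" for N :: "('a \<times> nat) set" and x
    have "\<exists>A. balanced_family c V k q (mult N) A" if N: "N \<in> nsets ?W K" for N
    proof (rule less.IH[OF q(2,1)])
      show "\<forall>x\<in>V. mult N x \<le> q"
      proof
        fix x
        have "mult N x \<le> card {..<q}" unfolding mult_def by (intro card_mono) auto
        then show "mult N x \<le> q" by simp
      qed
      have "N = (SIGMA x:V. {i. i < q \<and> (x, i) \<in> N})" using N by (auto simp: nsets_def)
      then have "card N = (\<Sum>x\<in>V. mult N x)"
        unfolding mult_def using V by (subst card_SigmaI[symmetric]) auto
      then show "card C * (q - 1) + q * (k - 1) < sum (mult N) V"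
        using N by (simp add: nsets_def K_def)
    qed
    then obtain fam where fam: "\<And>N. N \<in> nsets ?W K \<Longrightarrow> balanced_family c V k q (mult N) (fam N)"
      by metis
    \<comment> \<open>The family of \<open>N\<close> is monochromatic, so its member 0 represents
      the colour.\<close>
    let ?c = "\<lambda>N. c (fam N 0)"
    \<comment> \<open>The capacity \<open>b x\<close> is cut into \<open>q\<close> portions of at
      most \<open>p\<close>, one per clone; truncated subtraction makes exhausted portions
      0.\<close>
    define b' where "b' = (\<lambda>(x, i). min p (b x - i * p))"
    have b': "(\<Sum>i<q. b' (x, i)) = b x" if "x \<in> V" for x
      using less.prems(2) that r by (simp add: b'_def sum_min_chunks mult.commute)
    have "\<exists>Ns. balanced_family ?c ?W K p b' Ns"
    proof (rule balanced_family_prime[OF p(1) _ _ C])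
      show "finite ?W" "\<forall>y\<in>?W. b' y \<le> p" "1 \<le> K" using V by (auto simp: b'_def K_def)
      show "?c \<in> nsets ?W K \<rightarrow> C" using balanced_familyD(1)[OF fam pos(2)] c by blast
      have "sum b' ?W = sum b V" by (simp add: sum.cartesian_product' b')
      moreover have "card C * (p - 1) + p * (K - 1) = card C * (r - 1) + r * (k - 1)"
        using prime_gt_0_nat[OF p(1)] q(1) k unfolding r K_def
        by (cases p; cases q; cases k) (simp_all add: algebra_simps)
      ultimately show "card C * (p - 1) + p * (K - 1) < sum b' ?W" using less.prems(3) by simp
    qed
    then obtain Ns where Ns: "balanced_family ?c ?W K p b' Ns" by blast
    define A where "A i = fam (Ns (i div q)) (i mod q)" for i
    have fam_Ns: "balanced_family c V k q (mult (Ns j)) (fam (Ns j))" if "j < p" for j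
      by (rule fam[OF balanced_familyD(1)[OF Ns that]])
    have idx: "i div q < p" "i mod q < q" if "i < r" for i
      using that q(1) unfolding r by (simp_all add: less_mult_imp_div_less)
    have colour: "c (A i) = c (fam (Ns 0) 0)" if "i < r" for i
    proof -
      have "c (A i) = ?c (Ns (i div q))"
        unfolding A_def by (rule balanced_familyD(2)[OF fam_Ns[OF idx(1)[OF that]] idx(2)[OF that] pos(2)])
      also have "\<dots> = ?c (Ns 0)"
        by (rule balanced_familyD(2)[OF Ns idx(1)[OF that] pos(1)])
      finally show ?thesis .
    qed
    have "card {i. i < r \<and> x \<in> A i} \<le> b x" if x: "x \<in> V" for x
    proof -
      have "card {i. i < r \<and> x \<in> A i} = (\<Sum>j<p. \<Sum>l<q. of_bool (x \<in> A (j * q + l)))"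
        unfolding card_lessThan_eq_sum r sum_lessThan_mult ..
      also have "\<dots> = (\<Sum>j<p. card {l. l < q \<and> x \<in> fam (Ns j) l})"
        unfolding card_lessThan_eq_sum by (intro sum.cong refl) (simp add: A_def)
      \<comment> \<open>Coverage of \<open>x\<close> is bounded by its clones in the sets
        \<open>Ns j\<close>, which are then counted clone by clone.\<close>
      also have "\<dots> \<le> (\<Sum>j<p. mult (Ns j) x)"
        by (intro sum_mono balanced_familyD(3)[OF fam_Ns x]) simp
      also have "\<dots> = (\<Sum>i<q. card {j. j < p \<and> (x, i) \<in> Ns j})"
        unfolding mult_def card_lessThan_eq_sum by (rule sum.swap)
      also have "\<dots> \<le> (\<Sum>i<q. b' (x, i))"
        using x by (intro sum_mono balanced_familyD(3)[OF Ns]) simp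
      finally show ?thesis by (simp add: b'[OF x])
    qed
    moreover have "A i \<in> nsets V k" if "i < r" for i
      unfolding A_def by (rule balanced_familyD(1)[OF fam_Ns[OF idx(1)[OF that]] idx(2)[OF that]])
    ultimately have "balanced_family c V k r b A"
      using colour unfolding balanced_family_def by metis
    then show ?thesis by blast
  qed
qed

section \<open>From constant capacity to empty intersections\<close>

theorem theorem1p1:
  fixes r k n s t :: nat and p \<alpha> :: "nat \<Rightarrow> nat"
    and C :: "'c set" and c :: "nat set \<Rightarrow> 'c"
  assumes "2 \<le> r" and "1 \<le> k" and "s * k \<le> n"
    and "\<forall>i\<in>{1..t}. prime (p i) \<and> odd (p i)"
    and "inj_on p {1..t}"
    and "r = 2 ^ \<alpha> 0 * (\<Prod>i=1..t. p i ^ \<alpha> i)"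
    and "2 \<le> s"
    and "s \<le> 2 ^ \<alpha> 0 * (\<Prod>i=1..t. (p i - 1) ^ \<alpha> i)"
    and "finite C" and "c \<in> nsets {1..n} k \<rightarrow> C"
  shows
    "(int (card C) < \<lceil>((real s - 1) * real n - real r * (real k - 1)) / (real r - 1)\<rceil> \<longrightarrow>
       (\<exists>A. (\<forall>i\<in>{1..r}. A i \<in> nsets {1..n} k) \<and>
            (\<forall>i\<in>{1..r}. \<forall>j\<in>{1..r}. c (A i) = c (A j)) \<and>
            (\<forall>I\<in>nsets {1..r} s. (\<Inter>i\<in>I. A i) = {}))) \<and>
     ((\<forall>A. (\<forall>i\<in>{1..r}. A i \<in> nsets {1..n} k) \<and>
            (\<forall>i\<in>{1..r}. \<forall>j\<in>{1..r}. c (A i) = c (A j)) \<longrightarrow>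
            (\<exists>I\<in>nsets {1..r} s. (\<Inter>i\<in>I. A i) \<noteq> {})) \<longrightarrow>
       \<lceil>((real s - 1) * real n - real r * (real k - 1)) / (real r - 1)\<rceil> \<le> int (card C))"
proof -
  let ?bound = "\<lceil>((real s - 1) * real n - real r * (real k - 1)) / (real r - 1)\<rceil>"
  \<comment> \<open>This comparison yields \<open>s \<le> r\<close>, so the constant capacity
    \<open>s - 1\<close> is admissible.\<close>
  have "(\<Prod>i=1..t. (p i - 1) ^ \<alpha> i) \<le> (\<Prod>i=1..t. p i ^ \<alpha> i)"
    by (intro prod_mono) (auto intro: power_mono)
  then have "s \<le> r" using assms(6,8) by (meson le_trans mult_le_mono2)
  have main: "\<exists>A. (\<forall>i\<in>{1..r}. A i \<in> nsets {1..n} k) \<and>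
      (\<forall>i\<in>{1..r}. \<forall>j\<in>{1..r}. c (A i) = c (A j)) \<and>
      (\<forall>I\<in>nsets {1..r} s. (\<Inter>i\<in>I. A i) = {})" if less: "int (card C) < ?bound"
  proof -
    \<comment> \<open>An integer is below the ceiling exactly when it is below the fraction.\<close>
    have "real (card C) < ((real s - 1) * real n - real r * (real k - 1)) / (real r - 1)"
      using less by (simp add: less_ceiling_iff)
    then have "real (card C) * (real r - 1) + real r * (real k - 1) < (real s - 1) * real n"
      using assms(1) by (simp add: field_simps)
    then have "real (card C * (r - 1) + r * (k - 1)) < real ((s - 1) * n)"
      using assms(1,2,7) by (simp add: of_nat_diff)
    then have "card C * (r - 1) + r * (k - 1) < (\<Sum>x\<in>{1..n}. s - 1)"
      unfolding of_nat_less_iff by (simp add: mult.commute)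
    then obtain A where A: "balanced_family c {1..n} k r (\<lambda>_. s - 1) A"
      using balanced_family_exists[of r "{1..n}" "\<lambda>_. s - 1" C c k] assms(1,2,9,10) \<open>s \<le> r\<close>
      by (metis Suc_1 Suc_leD diff_le_self finite_atLeastAtMost le_trans)
    \<comment> \<open>A common point of \<open>s\<close> sets would be covered more than
      \<open>s - 1\<close> times. The shift by one translates indices from 1 into indices from
      0.\<close>
    have "(\<Inter>i\<in>I. A (i - 1)) = {}" if I: "I \<in> nsets {1..r} s" for I
    proof (rule ccontr)
      assume "\<not> ?thesis"
      then obtain x where x: "\<And>i. i \<in> I \<Longrightarrow> x \<in> A (i - 1)" by auto
      have I': "I \<subseteq> {1..r}" "card I = s" using I by (auto simp: nsets_def)
      \<comment> \<open>An index in \<open>I\<close> is needed to place \<open>x\<close> in the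
        ground set, where the capacity bound applies.\<close>
      then obtain i where i: "i \<in> I" using assms(7) by (metis card.empty ex_in_conv not_numeral_le_zero)
      then have "i - 1 < r" using I' by (auto simp: subset_iff)
      then have "A (i - 1) \<in> nsets {1..n} k" by (rule balanced_familyD(1)[OF A])
      then have "x \<in> {1..n}" using x[OF i] by (auto simp: nsets_def)
      have inj: "inj_on (\<lambda>i. i - 1) {1..r}" by (auto simp: inj_on_def)
      have "s = card ((\<lambda>i. i - 1) ` I)"
        using I' inj_on_subset[OF inj I'(1)] by (simp add: card_image)
      also have "\<dots> \<le> card {i. i < r \<and> x \<in> A i}"
        using I' x by (intro card_mono) (auto simp: subset_iff)
      also have "\<dots> \<le> s - 1" by (rule balanced_familyD(3)[OF A \<open>x \<in> {1..n}\<close>])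
      finally show False using assms(7) by simp
    qed
    moreover have "i - 1 < r" if "i \<in> {1..r}" for i using that by auto
    ultimately show ?thesis using balanced_familyD(1,2)[OF A]
      by (intro exI[of _ "\<lambda>i. A (i - 1)"]) blast
  qed
  show ?thesis
  proof (intro conjI impI)
    assume *: "\<forall>A. (\<forall>i\<in>{1..r}. A i \<in> nsets {1..n} k) \<and>
        (\<forall>i\<in>{1..r}. \<forall>j\<in>{1..r}. c (A i) = c (A j)) \<longrightarrow>
        (\<exists>I\<in>nsets {1..r} s. (\<Inter>i\<in>I. A i) \<noteq> {})"
    show "?bound \<le> int (card C)"
    proof (rule ccontr)
      assume "\<not> ?thesis"
      then have "int (card C) < ?bound" by simp
      from main[OF this] obtain A where A: "\<forall>i\<in>{1..r}. A i \<in> nsets {1..n} k"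
        "\<forall>i\<in>{1..r}. \<forall>j\<in>{1..r}. c (A i) = c (A j)" "\<forall>I\<in>nsets {1..r} s. (\<Inter>i\<in>I. A i) = {}"
        by (elim exE conjE)
      from *[THEN spec, THEN mp, OF conjI[OF A(1,2)]] A(3) show False by blast
    qed
  qed (rule main)
qed

end
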